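(* Let $0<U_1<U_2$ and $0<\varepsilon<\hbar\omega_D$ be real constants with $\varepsilon$ small enough that $U_1\log(\hbar\omega_D/\varepsilon)>1$. Let $U(\cdot,\cdot)\in C([\varepsilon,\hbar\omega_D]^2)$ satisfy $U_1\le U(x,\xi)\le U_2$ at all $(x,\xi)\in[\varepsilon,\hbar\omega_D]^2$. Let $\tau_2$, $\Delta_1$, $\Delta_2$ and $V_T$ be as defined in the context. Let $T\in[0,\tau_2]$ be fixed. Then there is a unique nonnegative solution $u_0(T,\cdot)\in V_T$ to the BCS gap equation $$u_0(T, x) = \int_\varepsilon^{\hbar\omega_D} \frac{U(x, \xi)\, u_0(T, \xi)}{\sqrt{\xi^2 + u_0(T, \xi)^2}} \tanh \frac{\sqrt{\xi^2 + u_0(T, \xi)^2}}{2T}\, d\xi, \qquad x\in[\varepsilon,\hbar\omega_D].$$ Consequently, the solution is continuous with respect to $x$ and varies with the temperature as follows: $$\Delta_1(T) \leq u_0(T, x) \leq \Delta_2(T) \quad \text{at } (T, x) \in [0, \tau_2] \times [\varepsilon, \hbar\omega_D].$$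
   Context: Here $\hbar\omega_D>0$ is treated as a single positive real constant, and $T\ge 0$ is the absolute temperature. At $T=0$ every factor $\tanh\frac{(\cdot)}{2T}$ is understood as its limit as $T\downarrow 0$, i.e. as $1$. For $k=1,2$, the number $\tau_k>0$ is defined by $$1 = U_k \int_\varepsilon^{\hbar\omega_D} \frac{1}{\xi} \tanh \frac{\xi}{2\tau_k}\, d\xi,$$ and $\Delta_k:[0,\tau_k]\to[0,\infty)$ is the unique nonnegative solution to the simple gap equation $$1 = U_k \int_\varepsilon^{\hbar\omega_D} \frac{1}{\sqrt{\xi^2 + \Delta_k(T)^2}} \tanh \frac{\sqrt{\xi^2 + \Delta_k(T)^2}}{2T}\, d\xi,\qquad 0\le T\le\tau_k.$$ It is continuous and strictly decreasing with $\Delta_k(\tau_k)=0$. One sets $\Delta_k(T)=0$ for $T>\tau_k$. One has $\tau_1<\tau_2$, with $\Delta_1(T)<\Delta_2(T)$ for $0\le T<\tau_2$ and $\Delta_1(T)=\Delta_2(T)=0$ for $T\ge\tau_2$. For $0\le T\le\tau_2$, with $C[\varepsilon,\hbar\omega_D]$ the Banach space of continuous real functions of $x\in[\varepsilon,\hbar\omega_D]$, $$V_T = \{u(T, \cdot) \in C[\varepsilon, \hbar\omega_D] : \Delta_1(T) \leq u(T, x) \leq \Delta_2(T) \text{ at } x \in [\varepsilon, \hbar\omega_D]\}.$$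
   Formalization: Uniqueness in V_T is claimed up to the zero function when T ≥ τ₁: there Δ₁(T)=0, so u=0 always lies in V_T and solves the equation, and e.g. for U ≡ U₂, τ₁ ≤ T < τ₂, the constant Δ₂(T) is a second solution. *)

theory Defs
  imports "HOL-Analysis.Analysis"
begin

(* Throughout, eps is the lower cutoff, w stands for the single positive constant
   (hbar omega_D), K for a constant coupling and T for the temperature. *)

(* tanh (E / (2 T)), read at T = 0 as its limit for T tending to 0 from above (E > 0). *)
definition thermal :: "real \<Rightarrow> real \<Rightarrow> real" where
  "thermal T E = (if T = 0 then 1 else tanh (E / (2 * T)))"

definition tau :: "real \<Rightarrow> real \<Rightarrow> real \<Rightarrow> real" where
  "tau eps w K = (THE t. 0 < t \<and>
     1 = K * integral {eps..w} (\<lambda>\<xi>. 1 / \<xi> * tanh (\<xi> / (2 * t))))"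

definition Delta :: "real \<Rightarrow> real \<Rightarrow> real \<Rightarrow> real \<Rightarrow> real" where
  "Delta eps w K T =
     (if T \<le> tau eps w K
      then (THE d. 0 \<le> d \<and>
              1 = K * integral {eps..w}
                    (\<lambda>\<xi>. 1 / sqrt (\<xi>\<^sup>2 + d\<^sup>2) * thermal T (sqrt (\<xi>\<^sup>2 + d\<^sup>2))))
      else 0)"

(* Elements of C[eps, w] are represented by functions on all reals; only their values
   on {eps..w} matter, so equality of elements is equality on {eps..w}. *)
definition V :: "real \<Rightarrow> real \<Rightarrow> real \<Rightarrow> real \<Rightarrow> real \<Rightarrow> (real \<Rightarrow> real) set" where
  "V eps w U1 U2 T =
     {u. continuous_on {eps..w} u \<and>
         (\<forall>x\<in>{eps..w}. Delta eps w U1 T \<le> u x \<and> u x \<le> Delta eps w U2 T)}"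

(* The zero function satisfies this equation at every temperature, and it belongs to V
   as soon as T \<ge> tau eps w U1. *)
definition solves_gap_eq ::
  "real \<Rightarrow> real \<Rightarrow> (real \<Rightarrow> real \<Rightarrow> real) \<Rightarrow> real \<Rightarrow> (real \<Rightarrow> real) \<Rightarrow> bool" where
  "solves_gap_eq eps w U T u \<longleftrightarrow>
     (\<forall>x\<in>{eps..w}.
        u x = integral {eps..w}
          (\<lambda>\<xi>. U x \<xi> * u \<xi> / sqrt (\<xi>\<^sup>2 + (u \<xi>)\<^sup>2) * thermal T (sqrt (\<xi>\<^sup>2 + (u \<xi>)\<^sup>2))))"

end

theory Submission imports Defs begin

text \<open>With E = sqrt (\<xi>^2 + u^2), the flux u * thermal T E / E increases with u \<ge> 0 while its quotient by u
  strictly decreases. Hence the integral operator is monotone and strictly sublinear, and the constants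
  Delta eps w U1 T and Delta eps w U2 T are a sub- and a supersolution.

  Existence: iterating from the constant supersolution gives a decreasing sequence. Since the flux is
  at most 1, the iterates share a modulus of continuity coming from U, so their pointwise limit
  is continuous; it is a solution by dominated convergence, and it dominates every other solution.

  Uniqueness: a solution that is positive somewhere is positive everywhere, and the minimum of its
  quotient by the maximal solution cannot be below 1 by strict sublinearity. The zero solution
  lies in V only if Delta eps w U1 T = 0, that is, T \<ge> tau eps w U1.\<close>

section \<open>The kernel of the gap equation\<close>

text \<open>The sign of the derivative of tanh y / y is that of y (1 - tanh^2 y) - tanh y, which
  vanishes at 0 and decreases on the positive axis, its own derivative being - 2 y tanh y (1 -
  tanh^2 y).\<close>

lemma tanh_over_id_strict_antimono:
  fixes a b :: real
  assumes "0 < a" "a < b"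
  shows "tanh b / b < tanh a / a"
proof -
  have aux: "y * (1 - tanh y ^ 2) - tanh y < 0" if y: "0 < y" for y :: real
  proof -
    have "y * (1 - tanh y ^ 2) - tanh y < 0 * (1 - tanh 0 ^ 2) - tanh (0::real)"
    proof (rule DERIV_neg_imp_decreasing_open [OF y])
      fix x :: real assume x: "0 < x" "x < y"
      have lt: "tanh x ^ 2 < 1"
        using x tanh_real_lt_1[of x] by (simp add: power_less_one_iff abs_square_less_1)
      have "((\<lambda>y. y * (1 - tanh y ^ 2) - tanh y) has_real_derivative
          - (2 * x * tanh x * (1 - tanh x ^ 2))) (at x)"
        by (auto intro!: derivative_eq_intros simp: algebra_simps power2_eq_square)
      moreover have "0 < 2 * x * tanh x * (1 - tanh x ^ 2)"
        using x lt by simp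
      ultimately show "\<exists>d. ((\<lambda>y. y * (1 - tanh y ^ 2) - tanh y) has_real_derivative d) (at x) \<and> d < 0"
        by (metis neg_less_0_iff_less)
    qed (auto intro!: continuous_intros)
    then show ?thesis by simp
  qed
  show ?thesis
  proof (rule DERIV_neg_imp_decreasing [OF assms(2)])
    fix x assume "a \<le> x" "x \<le> b"
    then have x: "0 < x" using assms by simp
    have "((\<lambda>y. tanh y / y) has_real_derivative (x * (1 - tanh x ^ 2) - tanh x) / (x * x)) (at x)"
      using x by (auto intro!: derivative_eq_intros simp: algebra_simps)
    moreover have "(x * (1 - tanh x ^ 2) - tanh x) / (x * x) < 0"
      using aux[OF x] x by (simp add: divide_neg_pos)
    ultimately show "\<exists>d. ((\<lambda>y. tanh y / y) has_real_derivative d) (at x) \<and> d < 0" by blast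
  qed
qed

section \<open>The thermal factor: bounds, monotonicity, continuity\<close>

lemma thermal_pos: "0 \<le> T \<Longrightarrow> 0 < E \<Longrightarrow> 0 < thermal T E"
  by (auto simp: thermal_def)

lemma thermal_le_1: "thermal T E \<le> 1"
  using tanh_real_lt_1[of "E / (2 * T)"] by (auto simp: thermal_def)

lemma thermal_mono: "0 \<le> T \<Longrightarrow> E \<le> F \<Longrightarrow> thermal T E \<le> thermal T F"
  by (auto simp: thermal_def divide_right_mono)

lemma thermal_strict_antimono_temp:
  "0 \<le> S \<Longrightarrow> S < T \<Longrightarrow> 0 < E \<Longrightarrow> thermal T E < thermal S E"
  by (auto simp: thermal_def tanh_real_lt_1 divide_strict_left_mono)

text \<open>At zero temperature the quotient is 1 / E; otherwise it is tanh y / y at y = E / (2 T),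
  up to the factor 1 / (2 T).\<close>

lemma thermal_over_id_strict_antimono:
  assumes "0 \<le> T" "0 < a" "a < b"
  shows "thermal T b / b < thermal T a / a"
proof (cases "T = 0")
  case True
  then show ?thesis using assms by (simp add: thermal_def divide_strict_left_mono)
next
  case False
  then have T: "0 < T" using assms by simp
  have "tanh (b / (2*T)) / (b / (2*T)) < tanh (a / (2*T)) / (a / (2*T))"
    using assms T by (intro tanh_over_id_strict_antimono) (auto simp: divide_strict_right_mono)
  then show ?thesis using T assms by (simp add: thermal_def field_simps)
qed

lemma continuous_on_thermal:
  assumes "0 \<le> T" "continuous_on S f"
  shows "continuous_on S (\<lambda>p. thermal T (f p))"
  by (cases "T = 0") (use assms in \<open>auto simp: thermal_def intro!: continuous_intros\<close>)

text \<open>The flux divided by \<open>u\<close>, in a form that also makes sense at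
  \<open>u = 0\<close>. For constant \<open>u\<close> it is the integrand of the simple gap
  equation, so one kernel serves both equations.\<close>

definition gap_kernel :: "real \<Rightarrow> real \<Rightarrow> real \<Rightarrow> real" where
  "gap_kernel T \<xi> u = thermal T (sqrt (\<xi>\<^sup>2 + u\<^sup>2)) / sqrt (\<xi>\<^sup>2 + u\<^sup>2)"

lemma sqrt_sum_squares_pos: "0 < x \<Longrightarrow> 0 < sqrt (x\<^sup>2 + (y::real)\<^sup>2)"
  by (simp add: add_pos_nonneg)

lemma gap_kernel_pos: "0 \<le> T \<Longrightarrow> 0 < \<xi> \<Longrightarrow> 0 < gap_kernel T \<xi> u"
  unfolding gap_kernel_def
  by (intro divide_pos_pos thermal_pos sqrt_sum_squares_pos)

text \<open>\<open>u\<close> enters only through E, which increases with \<open>u\<close>, while the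
  thermal factor over E decreases in E. This gives both the strict sublinearity of the flux and the
  uniqueness of the simple gap.\<close>

lemma gap_kernel_strict_antimono:
  assumes "0 \<le> T" "0 < \<xi>" "0 \<le> u" "u < v"
  shows "gap_kernel T \<xi> v < gap_kernel T \<xi> u"
  unfolding gap_kernel_def
  by (intro thermal_over_id_strict_antimono)
     (use assms in \<open>auto simp: add_pos_nonneg power_strict_mono\<close>)

lemma continuous_on_gap_kernel:
  assumes "0 \<le> T" "continuous_on S f" "continuous_on S g" "\<And>p. p \<in> S \<Longrightarrow> 0 < f p"
  shows "continuous_on S (\<lambda>p. gap_kernel T (f p) (g p))"
proof -
  have "\<forall>p\<in>S. sqrt ((f p)\<^sup>2 + (g p)\<^sup>2) \<noteq> 0"
    using sqrt_sum_squares_pos assms(4) by (metis less_irrefl)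
  then show ?thesis
    unfolding gap_kernel_def using assms
    by (intro continuous_on_divide continuous_on_thermal) (auto intro!: continuous_intros)
qed

text \<open>The flux is the product of u / E and the thermal factor at E, both nonnegative and
  nondecreasing in \<open>u\<close>.\<close>

lemma gap_flux_mono:
  assumes "0 \<le> T" "0 < \<xi>" "0 \<le> u" "u \<le> v"
  shows "u * gap_kernel T \<xi> u \<le> v * gap_kernel T \<xi> v"
proof -
  let ?E = "\<lambda>u. sqrt (\<xi>\<^sup>2 + u\<^sup>2)"
  have pos: "0 < ?E u" "0 < ?E v" using sqrt_sum_squares_pos[OF assms(2)] by blast+
  have sq: "u\<^sup>2 \<le> v\<^sup>2" using assms by (simp add: power_mono)
  \<comment> \<open>Squaring clears the roots: once u^2 v^2 is cancelled, u^2 \<xi>^2 \<le> v^2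
    \<xi>^2 remains.\<close>
  have "(u * ?E v)\<^sup>2 \<le> (v * ?E u)\<^sup>2"
    using sq mult_right_mono[OF sq, of "\<xi>\<^sup>2"] by (simp add: power_mult_distrib algebra_simps)
  then have "u * ?E v \<le> v * ?E u"
    by (rule power2_le_imp_le) (use assms in simp)
  then have "u / ?E u \<le> v / ?E v"
    using pos by (simp add: pos_divide_le_eq pos_le_divide_eq)
  moreover have "thermal T (?E u) \<le> thermal T (?E v)"
    using assms sq by (intro thermal_mono) auto
  ultimately have "u / ?E u * thermal T (?E u) \<le> v / ?E v * thermal T (?E v)"
    using assms pos by (intro mult_mono) (auto intro!: less_imp_le[OF thermal_pos])
  then show ?thesis by (simp add: gap_kernel_def)
qed

text \<open>The thermal factor is at most 1 and E is at least \<open>u\<close>. The bound makes the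
  gap integral small for a large constant gap.\<close>

lemma gap_kernel_le:
  assumes "0 \<le> T" "0 < \<xi>" "0 < u"
  shows "gap_kernel T \<xi> u \<le> 1 / u"
proof -
  have "u \<le> sqrt (\<xi>\<^sup>2 + u\<^sup>2)" using assms by (intro real_le_rsqrt) auto
  then show ?thesis
    unfolding gap_kernel_def using assms thermal_le_1
    by (intro frac_le) (auto intro!: thermal_pos sqrt_sum_squares_pos)
qed

lemma gap_flux_le_1:
  assumes "0 \<le> T" "0 < \<xi>" "0 \<le> u"
  shows "u * gap_kernel T \<xi> u \<le> 1"
  using gap_kernel_le[OF assms(1,2), of u] assms(3)
  by (cases "u = 0") (auto simp: field_simps)

section \<open>The simple gap equation\<close>

text \<open>For \<open>d = 0\<close> and positive \<open>T\<close> this is the integral defining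
  \<open>tau\<close>, for general \<open>d\<close> the one defining \<open>Delta\<close>; both are
  roots of \<open>K * gap_integral eps w T d = 1\<close>, one in \<open>T\<close>, the other in
  \<open>d\<close>.\<close>

definition gap_integral :: "real \<Rightarrow> real \<Rightarrow> real \<Rightarrow> real \<Rightarrow> real" where
  "gap_integral eps w T d = integral {eps..w} (\<lambda>\<xi>. gap_kernel T \<xi> d)"

lemma gap_integral_strict_antimono:
  assumes "0 < eps" "eps < w" "0 \<le> T" "0 \<le> d" "d < e"
  shows "gap_integral eps w T e < gap_integral eps w T d"
  unfolding gap_integral_def
  by (rule integral_less_real)
     (use assms in \<open>auto intro!: continuous_on_gap_kernel continuous_intros gap_kernel_strict_antimono\<close>)

lemma gap_integral_strict_antimono_temp:
  assumes "0 < eps" "eps < w" "0 \<le> S" "S < T"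
  shows "gap_integral eps w T d < gap_integral eps w S d"
  unfolding gap_integral_def
proof (rule integral_less_real)
  fix x assume "x \<in> {eps<..<w}"
  then have "0 < x" using assms by simp
  then show "gap_kernel T x d < gap_kernel S x d"
    using assms unfolding gap_kernel_def
    by (intro divide_strict_right_mono thermal_strict_antimono_temp sqrt_sum_squares_pos)
qed (use assms in \<open>auto intro!: continuous_on_gap_kernel continuous_intros\<close>)

lemma gap_kernel_0: "0 < \<xi> \<Longrightarrow> gap_kernel T \<xi> 0 = thermal T \<xi> / \<xi>"
  by (simp add: gap_kernel_def)

section \<open>The critical temperature\<close>

lemma integral_inverse_real:
  fixes a b :: real
  assumes "0 < a" "a \<le> b"
  shows "integral {a..b} (\<lambda>x. 1 / x) = ln (b / a)"
proof -
  have "((\<lambda>x. 1 / x) has_integral (ln b - ln a)) {a..b}"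
    using assms by (intro fundamental_theorem_of_calculus)
      (auto intro!: derivative_eq_intros simp flip: has_real_derivative_iff_has_vector_derivative)
  then show ?thesis using assms by (simp add: integral_unique ln_div)
qed

text \<open>Intermediate value theorem in the temperature: the right side exceeds 1 at some low
  temperature \<open>a\<close>, because its limit \<open>K * ln (w / eps)\<close> does, and is below
  1 at some high temperature \<open>b\<close>, because it tends to 0.\<close>

lemma ex_critical_temperature:
  assumes "0 < eps" "eps < w" "0 < K" "K * ln (w / eps) > 1"
  shows "\<exists>t>0. 1 = K * gap_integral eps w t 0"
proof -
  have cont_ker: "continuous_on {eps..w} (\<lambda>\<xi>. gap_kernel t \<xi> 0)" if "0 \<le> t" for t
    using that assms by (auto intro!: continuous_on_gap_kernel continuous_intros)
  have L: "0 < ln (w / eps)" using assms by simp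
  \<comment> \<open>Here \<open>s\<close> stands for 1 / (2 t). Replacing tanh (s \<xi>) by its
    least value, attained at \<open>eps\<close>, leaves only the integral of 1 / \<xi>, the
    logarithm.\<close>
  have "((\<lambda>s. K * (tanh (s * eps) * ln (w / eps))) \<longlongrightarrow> K * (1 * ln (w / eps))) at_top"
    by (intro tendsto_intros filterlim_compose[OF tanh_real_at_top])
       (use assms in \<open>auto intro!: filterlim_at_top_mult_tendsto_pos filterlim_ident\<close>)
  then have "eventually (\<lambda>s. 1 < K * (tanh (s * eps) * ln (w / eps)) \<and> 0 < s) at_top"
    using assms by (intro eventually_conj order_tendstoD(1) eventually_gt_at_top) auto
  then obtain s where s: "0 < s" "1 < K * (tanh (s * eps) * ln (w / eps))"
    by (auto dest: eventually_happens)
  define a where "a = 1 / (2 * s)"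
  have a: "0 < a" using s by (simp add: a_def)
  have "tanh (s * eps) * ln (w / eps) = integral {eps..w} (\<lambda>\<xi>. tanh (s * eps) * (1 / \<xi>))"
    using assms by (simp only: integral_mult_right integral_inverse_real)
  also have "\<dots> \<le> gap_integral eps w a 0"
    unfolding gap_integral_def
  proof (rule integral_le)
    show "(\<lambda>\<xi>. gap_kernel a \<xi> 0) integrable_on {eps..w}"
      using cont_ker a by (intro integrable_continuous_interval) auto
    show "(\<lambda>\<xi>. tanh (s * eps) * (1 / \<xi>)) integrable_on {eps..w}"
      using assms by (intro integrable_continuous_interval) (auto intro!: continuous_intros)
    fix \<xi> assume \<xi>: "\<xi> \<in> {eps..w}"
    then show "tanh (s * eps) * (1 / \<xi>) \<le> gap_kernel a \<xi> 0"
      using assms s a by (auto simp: gap_kernel_0 thermal_def a_def mult.commute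
          intro!: divide_right_mono)
  qed
  finally have ga: "1 < K * gap_integral eps w a 0"
    using s assms(3) by (meson less_le_trans mult_le_cancel_left_pos)
  \<comment> \<open>Crude upper bound: the numerator is taken at \<open>w\<close>, the denominator
    at \<open>eps\<close>. It vanishes at high temperature because tanh 0 = 0.\<close>
  have "((\<lambda>t. K * (tanh (w / (2 * t)) / eps * (w - eps))) \<longlongrightarrow> K * (tanh 0 / eps * (w - eps))) at_top"
    by (intro tendsto_intros real_tendsto_divide_at_top[OF tendsto_const]
          filterlim_tendsto_pos_mult_at_top[OF tendsto_const] filterlim_ident)
       (use assms in auto)
  then have "eventually (\<lambda>t. K * (tanh (w / (2 * t)) / eps * (w - eps)) < 1 \<and> a < t) at_top"
    by (intro eventually_conj order_tendstoD(2) eventually_gt_at_top) auto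
  then obtain b where b: "a < b" "K * (tanh (w / (2 * b)) / eps * (w - eps)) < 1"
    by (auto dest: eventually_happens)
  have "gap_integral eps w b 0 \<le> integral {eps..w} (\<lambda>\<xi>. tanh (w / (2 * b)) / eps)"
    unfolding gap_integral_def
  proof (rule integral_le)
    show "(\<lambda>\<xi>. gap_kernel b \<xi> 0) integrable_on {eps..w}"
      using cont_ker a b by (intro integrable_continuous_interval) auto
    fix \<xi> assume \<xi>: "\<xi> \<in> {eps..w}"
    then show "gap_kernel b \<xi> 0 \<le> tanh (w / (2 * b)) / eps"
      using assms a b by (auto simp: gap_kernel_0 thermal_def intro!: frac_le divide_right_mono)
  qed auto
  also have "\<dots> = tanh (w / (2 * b)) / eps * (w - eps)"
    using assms by simp
  finally have gb: "K * gap_integral eps w b 0 < 1"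
    using b assms(3) by (meson le_less_trans mult_le_cancel_left_pos)
  \<comment> \<open>Since \<open>a\<close> is positive, the case distinction of
    \<open>thermal\<close> at zero temperature drops out and the integrand is jointly
    continuous.\<close>
  have "continuous_on {a..b} (\<lambda>t. integral (cbox eps w) (\<lambda>\<xi>. tanh (\<xi> / (2 * t)) / \<xi>))"
    using assms a by (intro integral_continuous_on_param)
      (auto simp: case_prod_unfold intro!: continuous_intros)
  moreover have "integral (cbox eps w) (\<lambda>\<xi>. tanh (\<xi> / (2 * t)) / \<xi>) = gap_integral eps w t 0"
    if "t \<in> {a..b}" for t
    unfolding gap_integral_def using that a assms
    by (auto intro!: integral_cong simp: gap_kernel_0 thermal_def)
  ultimately have "continuous_on {a..b} (\<lambda>t. gap_integral eps w t 0)"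
    by (rule continuous_on_eq)
  then have "continuous_on {a..b} (\<lambda>t. K * gap_integral eps w t 0)"
    by (intro continuous_intros)
  then obtain t where "a \<le> t" "K * gap_integral eps w t 0 = 1"
    using IVT2'[of "\<lambda>t. K * gap_integral eps w t 0" b 1 a] ga gb b by auto
  with a show ?thesis by (intro exI[of _ t]) auto
qed

text \<open>Justifies the definite description in \<open>tau\<close>: a root exists, and strict
  decrease in the temperature allows only one.\<close>

lemma tau_eq:
  assumes "0 < eps" "eps < w" "0 < K" "K * ln (w / eps) > 1"
  shows "0 < tau eps w K" "K * gap_integral eps w (tau eps w K) 0 = 1"
proof -
  have eq: "integral {eps..w} (\<lambda>\<xi>. 1 / \<xi> * tanh (\<xi> / (2 * t))) = gap_integral eps w t 0"
    if "0 < t" for t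
    unfolding gap_integral_def using that assms
    by (auto intro!: integral_cong simp: gap_kernel_0 thermal_def)
  have "\<exists>!t. 0 < t \<and> 1 = K * integral {eps..w} (\<lambda>\<xi>. 1 / \<xi> * tanh (\<xi> / (2 * t)))"
  proof (rule ex_ex1I)
    show "\<exists>t. 0 < t \<and> 1 = K * integral {eps..w} (\<lambda>\<xi>. 1 / \<xi> * tanh (\<xi> / (2 * t)))"
      using ex_critical_temperature[OF assms] eq by auto
    fix s t assume "0 < s \<and> 1 = K * integral {eps..w} (\<lambda>\<xi>. 1 / \<xi> * tanh (\<xi> / (2 * s)))"
      and "0 < t \<and> 1 = K * integral {eps..w} (\<lambda>\<xi>. 1 / \<xi> * tanh (\<xi> / (2 * t)))"
    then have st: "0 < s" "0 < t" and "1 = K * gap_integral eps w s 0" "1 = K * gap_integral eps w t 0"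
      using eq by auto
    then have "K * gap_integral eps w s 0 = K * gap_integral eps w t 0" by linarith
    then have "gap_integral eps w s 0 = gap_integral eps w t 0" using assms(3) by simp
    then show "s = t"
      using gap_integral_strict_antimono_temp[OF assms(1,2), of s t 0]
        gap_integral_strict_antimono_temp[OF assms(1,2), of t s 0] st
      by (cases s t rule: linorder_cases) auto
  qed
  from theI'[OF this] show "0 < tau eps w K" "K * gap_integral eps w (tau eps w K) 0 = 1"
    using eq[of "tau eps w K"] by (auto simp: tau_def)
qed

text \<open>Intermediate value theorem in \<open>d\<close>. Up to the critical temperature the right
  side is at least 1 at \<open>d = 0\<close>, by monotonicity in the temperature.\<close>

lemma ex_simple_gap:
  assumes "0 < eps" "eps < w" "0 < K" "K * ln (w / eps) > 1" "0 \<le> T" "T \<le> tau eps w K"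
  shows "\<exists>d\<ge>0. 1 = K * gap_integral eps w T d"
proof -
  have "gap_integral eps w (tau eps w K) 0 \<le> gap_integral eps w T 0"
    using gap_integral_strict_antimono_temp[OF assms(1,2,5), of "tau eps w K" 0] assms(6)
    by (cases "T = tau eps w K") auto
  then have g0: "1 \<le> K * gap_integral eps w T 0"
    using tau_eq(2)[OF assms(1-4)] assms(3) by (metis mult_le_cancel_left_pos)
  \<comment> \<open>Chosen so that the kernel bound 1 / b integrates to exactly 1 / K.\<close>
  define b where "b = K * (w - eps)"
  have b: "0 < b" using assms by (simp add: b_def)
  have "gap_integral eps w T b \<le> integral {eps..w} (\<lambda>\<xi>. 1 / b)"
    unfolding gap_integral_def using assms b
    by (intro integral_le integrable_continuous_interval)
       (auto intro!: continuous_on_gap_kernel continuous_intros gap_kernel_le)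
  also have "\<dots> = 1 / K" using assms by (simp add: b_def)
  finally have gb: "K * gap_integral eps w T b \<le> 1" using assms by (simp add: field_simps)
  have "continuous_on {0..b} (\<lambda>d. integral (cbox eps w) (\<lambda>\<xi>. gap_kernel T \<xi> d))"
    using assms by (intro integral_continuous_on_param)
      (auto simp: case_prod_unfold intro!: continuous_on_gap_kernel continuous_intros)
  then have "continuous_on {0..b} (\<lambda>d. K * gap_integral eps w T d)"
    unfolding gap_integral_def by (auto intro!: continuous_intros)
  then obtain d where "0 \<le> d" "K * gap_integral eps w T d = 1"
    using IVT2'[of "\<lambda>d. K * gap_integral eps w T d" b 1 0] g0 gb b by auto
  then show ?thesis by (intro exI[of _ d]) auto
qed

text \<open>Justifies the definite description in \<open>Delta\<close>, with uniqueness from the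
  strict decrease in \<open>d\<close>.\<close>

lemma Delta_eq:
  assumes "0 < eps" "eps < w" "0 < K" "K * ln (w / eps) > 1" "0 \<le> T" "T \<le> tau eps w K"
  shows "0 \<le> Delta eps w K T" "K * gap_integral eps w T (Delta eps w K T) = 1"
proof -
  have eq: "integral {eps..w} (\<lambda>\<xi>. 1 / sqrt (\<xi>\<^sup>2 + d\<^sup>2) * thermal T (sqrt (\<xi>\<^sup>2 + d\<^sup>2)))
      = gap_integral eps w T d" for d
    by (simp add: gap_integral_def gap_kernel_def)
  have "\<exists>!d. 0 \<le> d \<and> 1 = K * gap_integral eps w T d"
  proof (rule ex_ex1I)
    show "\<exists>d. 0 \<le> d \<and> 1 = K * gap_integral eps w T d"
      using ex_simple_gap[OF assms] by auto
    fix d e assume "0 \<le> d \<and> 1 = K * gap_integral eps w T d"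
      and "0 \<le> e \<and> 1 = K * gap_integral eps w T e"
    then have de: "0 \<le> d" "0 \<le> e"
      and "1 = K * gap_integral eps w T d" "1 = K * gap_integral eps w T e"
      by auto
    then have "K * gap_integral eps w T d = K * gap_integral eps w T e" by linarith
    then have "gap_integral eps w T d = gap_integral eps w T e" using assms(3) by simp
    then show "d = e"
      using gap_integral_strict_antimono[OF assms(1,2,5), of d e]
        gap_integral_strict_antimono[OF assms(1,2,5), of e d] de
      by (cases d e rule: linorder_cases) auto
  qed
  from theI'[OF this] show "0 \<le> Delta eps w K T" "K * gap_integral eps w T (Delta eps w K T) = 1"
    using assms(6) unfolding Delta_def eq by auto
qed

lemma Delta_nonneg:
  assumes "0 < eps" "eps < w" "0 < K" "K * ln (w / eps) > 1" "0 \<le> T"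
  shows "0 \<le> Delta eps w K T"
  by (cases "T \<le> tau eps w K") (use Delta_eq(1)[OF assms] in \<open>auto simp: Delta_def\<close>)

text \<open>Strictly below the critical temperature the value at \<open>d = 0\<close> exceeds 1, so
  0 is not a root. This later excludes the zero function from \<open>V\<close> below
  \<open>tau eps w U1\<close>.\<close>

lemma Delta_pos:
  assumes "0 < eps" "eps < w" "0 < K" "K * ln (w / eps) > 1" "0 \<le> T" "T < tau eps w K"
  shows "0 < Delta eps w K T"
proof -
  have "gap_integral eps w (tau eps w K) 0 < gap_integral eps w T 0"
    by (rule gap_integral_strict_antimono_temp) (use assms in auto)
  then have "1 < K * gap_integral eps w T 0"
    using tau_eq(2)[OF assms(1-4)] assms(3) by (metis mult_less_cancel_left_pos)
  then show ?thesis
    using Delta_eq[OF assms(1-5)] assms(6) by (cases "Delta eps w K T = 0") auto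
qed

section \<open>The integral operator\<close>

locale gap_equation =
  fixes U1 U2 eps w T :: real and U :: "real \<Rightarrow> real \<Rightarrow> real"
  assumes U1_pos: "0 < U1" and eps_pos: "0 < eps" and eps_less: "eps < w" and T_nonneg: "0 \<le> T"
    and cont_U: "continuous_on ({eps..w} \<times> {eps..w}) (\<lambda>(x, \<xi>). U x \<xi>)"
    and U_bounds: "\<And>x \<xi>. x \<in> {eps..w} \<Longrightarrow> \<xi> \<in> {eps..w} \<Longrightarrow> U1 \<le> U x \<xi> \<and> U x \<xi> \<le> U2"
begin

definition gap_op :: "(real \<Rightarrow> real) \<Rightarrow> real \<Rightarrow> real" where
  "gap_op u x = integral {eps..w} (\<lambda>\<xi>. U x \<xi> * (u \<xi> * gap_kernel T \<xi> (u \<xi>)))"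

lemma solves_gap_eq_iff: "solves_gap_eq eps w U T u \<longleftrightarrow> (\<forall>x\<in>{eps..w}. u x = gap_op u x)"
  by (simp add: solves_gap_eq_def gap_op_def gap_kernel_def mult.assoc)

lemma U_pos: "x \<in> {eps..w} \<Longrightarrow> \<xi> \<in> {eps..w} \<Longrightarrow> 0 < U x \<xi>"
  using U_bounds[of x \<xi>] U1_pos by linarith

lemma continuous_on_flux:
  assumes "continuous_on {eps..w} u"
  shows "continuous_on {eps..w} (\<lambda>\<xi>. u \<xi> * gap_kernel T \<xi> (u \<xi>))"
  using assms T_nonneg eps_pos by (auto intro!: continuous_on_gap_kernel continuous_intros)

lemma continuous_on_integrand:
  assumes "x \<in> {eps..w}" "continuous_on {eps..w} u"
  shows "continuous_on {eps..w} (\<lambda>\<xi>. U x \<xi> * (u \<xi> * gap_kernel T \<xi> (u \<xi>)))"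
proof -
  have "continuous_on {eps..w} (\<lambda>\<xi>. (\<lambda>(x, \<xi>). U x \<xi>) (x, \<xi>))"
    by (rule continuous_on_compose2[OF cont_U]) (use assms in \<open>auto intro!: continuous_intros\<close>)
  then show ?thesis
    using continuous_on_flux[OF assms(2)] by (simp add: continuous_on_mult)
qed

lemma flux_bounds:
  assumes "\<xi> \<in> {eps..w}" "0 \<le> u"
  shows "0 \<le> u * gap_kernel T \<xi> u" "u * gap_kernel T \<xi> u \<le> 1"
  using assms T_nonneg eps_pos gap_flux_le_1[of T \<xi> u] gap_kernel_pos[of T \<xi> u] by auto

lemma gap_op_mono:
  assumes x: "x \<in> {eps..w}" and u: "continuous_on {eps..w} u" and v: "continuous_on {eps..w} v"
    and le: "\<And>\<xi>. \<xi> \<in> {eps..w} \<Longrightarrow> 0 \<le> u \<xi> \<and> u \<xi> \<le> v \<xi>"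
  shows "gap_op u x \<le> gap_op v x"
  unfolding gap_op_def
proof (rule integral_le)
  fix \<xi> assume \<xi>: "\<xi> \<in> {eps..w}"
  then have "u \<xi> * gap_kernel T \<xi> (u \<xi>) \<le> v \<xi> * gap_kernel T \<xi> (v \<xi>)"
    using le[OF \<xi>] T_nonneg eps_pos by (intro gap_flux_mono) auto
  then show "U x \<xi> * (u \<xi> * gap_kernel T \<xi> (u \<xi>)) \<le> U x \<xi> * (v \<xi> * gap_kernel T \<xi> (v \<xi>))"
    using U_pos[OF x \<xi>] by simp
qed (use x u v in \<open>auto intro!: integrable_continuous_interval continuous_on_integrand\<close>)

text \<open>The flux lies between 0 and 1, so the modulus of continuity comes from \<open>U\<close>
  alone, which is uniformly continuous on the compact square. That \<open>d\<close> is chosen before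
  \<open>u\<close> lets continuity survive the limit of the iterates.\<close>

lemma gap_op_equicontinuous:
  assumes "0 < e"
  obtains d where "0 < d"
    "\<And>u x y. continuous_on {eps..w} u \<Longrightarrow> (\<And>\<xi>. \<xi> \<in> {eps..w} \<Longrightarrow> 0 \<le> u \<xi>) \<Longrightarrow>
       x \<in> {eps..w} \<Longrightarrow> y \<in> {eps..w} \<Longrightarrow> \<bar>x - y\<bar> < d \<Longrightarrow> \<bar>gap_op u x - gap_op u y\<bar> \<le> e"
proof -
  define e' where "e' = e / (w - eps)"
  have e': "0 < e'" using assms eps_less by (simp add: e'_def)
  have "uniformly_continuous_on ({eps..w} \<times> {eps..w}) (\<lambda>(x, \<xi>). U x \<xi>)"
    by (intro compact_uniformly_continuous cont_U compact_Times compact_Icc)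
  then obtain d where d: "0 < d"
    "\<And>p q. p \<in> {eps..w} \<times> {eps..w} \<Longrightarrow> q \<in> {eps..w} \<times> {eps..w} \<Longrightarrow> dist q p < d \<Longrightarrow>
       dist (case q of (x, \<xi>) \<Rightarrow> U x \<xi>) (case p of (x, \<xi>) \<Rightarrow> U x \<xi>) < e'"
    unfolding uniformly_continuous_on_def using e' by metis
  show thesis
  proof (rule that[OF d(1)])
    fix u :: "real \<Rightarrow> real" and x y
    assume u: "continuous_on {eps..w} u" "\<And>\<xi>. \<xi> \<in> {eps..w} \<Longrightarrow> 0 \<le> u \<xi>"
      and x: "x \<in> {eps..w}" and y: "y \<in> {eps..w}" and xy: "\<bar>x - y\<bar> < d"
    let ?F = "\<lambda>x \<xi>. U x \<xi> * (u \<xi> * gap_kernel T \<xi> (u \<xi>))"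
    have int: "?F x integrable_on {eps..w}" "?F y integrable_on {eps..w}"
      using x y u by (auto intro!: integrable_continuous_interval continuous_on_integrand)
    have "\<bar>gap_op u x - gap_op u y\<bar> = norm (integral {eps..w} (\<lambda>\<xi>. ?F x \<xi> - ?F y \<xi>))"
      using int by (simp add: gap_op_def integral_diff)
    also have "\<dots> \<le> integral {eps..w} (\<lambda>\<xi>. e')"
    proof (rule integral_norm_bound_integral)
      fix \<xi> assume \<xi>: "\<xi> \<in> {eps..w}"
      have "\<bar>U x \<xi> - U y \<xi>\<bar> < e'"
        using d(2)[of "(y, \<xi>)" "(x, \<xi>)"] x y \<xi> xy by (simp add: dist_Pair_Pair dist_real_def)
      then have "\<bar>U x \<xi> - U y \<xi>\<bar> * \<bar>u \<xi> * gap_kernel T \<xi> (u \<xi>)\<bar> \<le> e' * 1"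
        using flux_bounds[OF \<xi> u(2)[OF \<xi>]] by (intro mult_mono) auto
      then show "norm (?F x \<xi> - ?F y \<xi>) \<le> e'"
        by (simp add: abs_mult left_diff_distrib[symmetric])
    qed (use int in \<open>auto intro!: integrable_diff\<close>)
    also have "\<dots> = e" using eps_less by (simp add: e'_def)
    finally show "\<bar>gap_op u x - gap_op u y\<bar> \<le> e" .
  qed
qed

lemma continuous_on_gap_op:
  assumes "continuous_on {eps..w} u" "\<And>\<xi>. \<xi> \<in> {eps..w} \<Longrightarrow> 0 \<le> u \<xi>"
  shows "continuous_on {eps..w} (gap_op u)"
  unfolding continuous_on_iff
proof (intro ballI allI impI)
  fix x e :: real assume x: "x \<in> {eps..w}" and "0 < e"
  \<comment> \<open>The common modulus gives a weak inequality; halving \<open>e\<close> makes it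
    strict.\<close>
  then have "0 < e / 2" by simp
  then obtain d where d: "0 < d"
    "\<And>u x y. continuous_on {eps..w} u \<Longrightarrow> (\<And>\<xi>. \<xi> \<in> {eps..w} \<Longrightarrow> 0 \<le> u \<xi>) \<Longrightarrow>
       x \<in> {eps..w} \<Longrightarrow> y \<in> {eps..w} \<Longrightarrow> \<bar>x - y\<bar> < d \<Longrightarrow> \<bar>gap_op u x - gap_op u y\<bar> \<le> e / 2"
    by (rule gap_op_equicontinuous) blast
  have "dist (gap_op u y) (gap_op u x) < e" if "y \<in> {eps..w}" "dist y x < d" for y
    using d(2)[OF assms that(1) x] that(2) \<open>0 < e\<close> by (force simp: dist_real_def)
  then show "\<exists>d>0. \<forall>y\<in>{eps..w}. dist y x < d \<longrightarrow> dist (gap_op u y) (gap_op u x) < e"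
    using d(1) by blast
qed

text \<open>Monotone iteration downwards from the constant \<open>b\<close>. By the last conclusion
  every continuous solution with values between 0 and \<open>b\<close> lies below \<open>u\<close>,
  so that uniqueness only has to compare ordered pairs.\<close>

lemma maximal_solution:
  assumes ab: "0 \<le> a" "a \<le> b"
    and sub: "\<And>x. x \<in> {eps..w} \<Longrightarrow> a \<le> gap_op (\<lambda>_. a) x"
    and sup: "\<And>x. x \<in> {eps..w} \<Longrightarrow> gap_op (\<lambda>_. b) x \<le> b"
  obtains u where "continuous_on {eps..w} u" "\<And>x. x \<in> {eps..w} \<Longrightarrow> a \<le> u x \<and> u x \<le> b"
    "\<And>x. x \<in> {eps..w} \<Longrightarrow> u x = gap_op u x"
    "\<And>v x. continuous_on {eps..w} v \<Longrightarrow> (\<And>\<xi>. \<xi> \<in> {eps..w} \<Longrightarrow> 0 \<le> v \<xi> \<and> v \<xi> \<le> b) \<Longrightarrow>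
       (\<And>\<xi>. \<xi> \<in> {eps..w} \<Longrightarrow> v \<xi> = gap_op v \<xi>) \<Longrightarrow> x \<in> {eps..w} \<Longrightarrow> v x \<le> u x"
proof -
  define it where "it n = (gap_op ^^ n) (\<lambda>_. b)" for n
  have it_0: "it 0 = (\<lambda>_. b)" and it_Suc: "it (Suc n) = gap_op (it n)" for n
    by (simp_all add: it_def)
  have it: "continuous_on {eps..w} (it n) \<and> (\<forall>x\<in>{eps..w}. a \<le> it n x \<and> it n x \<le> b)" for n
  proof (induction n)
    case 0
    then show ?case using ab by (simp add: it_0)
  next
    case (Suc n)
    then have nonneg: "0 \<le> it n \<xi>" if "\<xi> \<in> {eps..w}" for \<xi>
      using ab(1) that order_trans by blast
    have "a \<le> it (Suc n) x \<and> it (Suc n) x \<le> b" if x: "x \<in> {eps..w}" for x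
    proof -
      \<comment> \<open>The next iterate is squeezed between the images of the two constants, which
        \<open>sub\<close> and \<open>sup\<close> control.\<close>
      have "gap_op (\<lambda>_. a) x \<le> gap_op (it n) x" "gap_op (it n) x \<le> gap_op (\<lambda>_. b) x"
        using Suc ab nonneg by (auto intro!: gap_op_mono[OF x])
      then show ?thesis using sub[OF x] sup[OF x] by (simp add: it_Suc)
    qed
    moreover have "continuous_on {eps..w} (it (Suc n))"
      using Suc nonneg by (auto simp: it_Suc intro!: continuous_on_gap_op)
    ultimately show ?case by blast
  qed
  have cont: "continuous_on {eps..w} (it n)" for n using it by blast
  have bds: "a \<le> it n x" "it n x \<le> b" "0 \<le> it n x" if "x \<in> {eps..w}" for n x
    using it[of n] ab(1) that order_trans by blast+
  \<comment> \<open>The first step is \<open>sup\<close>; monotonicity of the operator propagates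
    it.\<close>
  have dec: "it (Suc n) x \<le> it n x" if "x \<in> {eps..w}" for n x
    using that
  proof (induction n arbitrary: x)
    case 0
    then show ?case using sup by (simp add: it_Suc it_0)
  next
    case (Suc n)
    then show ?case
      unfolding it_Suc[of "Suc n"] it_Suc[of n]
      using cont[of "Suc n"] bds(3)[of _ "Suc n"]
      by (intro gap_op_mono) (auto simp: cont it_Suc)
  qed
  have "\<exists>L. (\<lambda>n. it n x) \<longlonglongrightarrow> L" if "x \<in> {eps..w}" for x
    using decseq_convergent[of "\<lambda>n. it n x" a] dec[OF that] bds(1)[OF that]
    by (metis decseq_Suc_iff)
  then obtain u where u: "\<And>x. x \<in> {eps..w} \<Longrightarrow> (\<lambda>n. it n x) \<longlonglongrightarrow> u x"
    by metis
  have ubds: "a \<le> u x \<and> u x \<le> b" if "x \<in> {eps..w}" for x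
    using LIMSEQ_le_const[OF u[OF that], of a] LIMSEQ_le_const2[OF u[OF that], of b] bds[OF that]
    by blast
  show thesis
  proof (rule that)
    show "continuous_on {eps..w} u"
      unfolding continuous_on_iff
    proof (intro ballI allI impI)
      fix x e :: real assume x: "x \<in> {eps..w}" and e: "0 < e"
      then have "0 < e / 2" by simp
      then obtain d where d: "0 < d"
        "\<And>u x y. continuous_on {eps..w} u \<Longrightarrow> (\<And>\<xi>. \<xi> \<in> {eps..w} \<Longrightarrow> 0 \<le> u \<xi>) \<Longrightarrow>
           x \<in> {eps..w} \<Longrightarrow> y \<in> {eps..w} \<Longrightarrow> \<bar>x - y\<bar> < d \<Longrightarrow> \<bar>gap_op u x - gap_op u y\<bar> \<le> e / 2"
        by (rule gap_op_equicontinuous) blast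
      have "dist (u y) (u x) < e" if y: "y \<in> {eps..w}" and yx: "dist y x < d" for y
      proof -
        \<comment> \<open>Shifted by one because the common modulus concerns images under
          \<open>gap_op\<close>.\<close>
        have "(\<lambda>n. \<bar>it (Suc n) y - it (Suc n) x\<bar>) \<longlonglongrightarrow> \<bar>u y - u x\<bar>"
          using LIMSEQ_Suc[OF u[OF x]] LIMSEQ_Suc[OF u[OF y]] by (intro tendsto_intros)
        moreover have "\<bar>it (Suc n) y - it (Suc n) x\<bar> \<le> e / 2" for n
          unfolding it_Suc by (rule d(2)) (use cont bds x y yx in \<open>auto simp: dist_real_def\<close>)
        ultimately have "\<bar>u y - u x\<bar> \<le> e / 2"
          by (intro LIMSEQ_le_const2) auto
        then show ?thesis using e by (simp add: dist_real_def)
      qed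
      then show "\<exists>d>0. \<forall>y\<in>{eps..w}. dist y x < d \<longrightarrow> dist (u y) (u x) < e"
        using d(1) by blast
    qed
  next
    fix x assume x: "x \<in> {eps..w}"
    \<comment> \<open>Dominated by the constant \<open>U2\<close>, as the flux is at most 1. The
      same sequence, being the iteration shifted by one, also tends to \<open>u x\<close>.\<close>
    have "(\<lambda>n. gap_op (it n) x) \<longlonglongrightarrow> gap_op u x"
      unfolding gap_op_def
    proof (rule dominated_convergence(2))
      show "(\<lambda>\<xi>. U x \<xi> * (it n \<xi> * gap_kernel T \<xi> (it n \<xi>))) integrable_on {eps..w}" for n
        using x cont by (intro integrable_continuous_interval continuous_on_integrand)
      show "(\<lambda>_. U2) integrable_on {eps..w}"
        by (intro integrable_continuous_interval continuous_on_const)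
      fix \<xi> assume \<xi>: "\<xi> \<in> {eps..w}"
      have "U x \<xi> * (it n \<xi> * gap_kernel T \<xi> (it n \<xi>)) \<le> U2 * 1" for n
        using U_pos[OF x \<xi>] U_bounds[OF x \<xi>] flux_bounds[OF \<xi> bds(3)[OF \<xi>]]
        by (intro mult_mono) auto
      then show "norm (U x \<xi> * (it n \<xi> * gap_kernel T \<xi> (it n \<xi>))) \<le> U2" for n
        using U_pos[OF x \<xi>] flux_bounds(1)[OF \<xi> bds(3)[OF \<xi>]]
        by (simp add: abs_of_nonneg)
      have "continuous_on UNIV (gap_kernel T \<xi>)"
        using \<xi> eps_pos T_nonneg by (intro continuous_on_gap_kernel) auto
      then have "(\<lambda>n. gap_kernel T \<xi> (it n \<xi>)) \<longlonglongrightarrow> gap_kernel T \<xi> (u \<xi>)"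
        using u[OF \<xi>] by (auto simp: continuous_on_eq_continuous_at intro: isCont_tendsto_compose)
      then show "(\<lambda>n. U x \<xi> * (it n \<xi> * gap_kernel T \<xi> (it n \<xi>)))
          \<longlonglongrightarrow> U x \<xi> * (u \<xi> * gap_kernel T \<xi> (u \<xi>))"
        using u[OF \<xi>] by (intro tendsto_intros)
    qed
    moreover have "(\<lambda>n. gap_op (it n) x) \<longlonglongrightarrow> u x"
      using LIMSEQ_Suc[OF u[OF x]] by (simp add: it_Suc)
    ultimately show "u x = gap_op u x" using LIMSEQ_unique by blast
  next
    fix v x
    assume v: "continuous_on {eps..w} v" "\<And>\<xi>. \<xi> \<in> {eps..w} \<Longrightarrow> 0 \<le> v \<xi> \<and> v \<xi> \<le> b"
      "\<And>\<xi>. \<xi> \<in> {eps..w} \<Longrightarrow> v \<xi> = gap_op v \<xi>" and x: "x \<in> {eps..w}"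
    \<comment> \<open>\<open>v\<close> is its own image, so monotonicity carries the comparison with
      \<open>b\<close> to every iterate.\<close>
    have "v y \<le> it n y" if "y \<in> {eps..w}" for n y
      using that
    proof (induction n arbitrary: y)
      case 0
      then show ?case using v(2) by (simp add: it_0)
    next
      case (Suc n)
      then have "gap_op v y \<le> gap_op (it n) y"
        using v cont by (intro gap_op_mono) auto
      then show ?case using v(3)[OF Suc.prems] by (simp add: it_Suc)
    qed
    then show "v x \<le> u x" using LIMSEQ_le_const[OF u[OF x]] x by blast
  qed (use ubds in auto)
qed

text \<open>Let t be the minimum of v / u, attained at x1. If t < 1, then t u(x1) is t times the
  image of u at x1, which is strictly less than the image of t u there, hence less than the image of
  v, that is v(x1) = t u(x1). So 1 \<le> t, and u \<le> t u \<le> v \<le> u.\<close>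

lemma comparable_solutions_eq:
  assumes u: "continuous_on {eps..w} u" "\<And>x. x \<in> {eps..w} \<Longrightarrow> u x = gap_op u x"
    and v: "continuous_on {eps..w} v" "\<And>x. x \<in> {eps..w} \<Longrightarrow> v x = gap_op v x"
    and vu: "\<And>x. x \<in> {eps..w} \<Longrightarrow> 0 \<le> v x \<and> v x \<le> u x"
    and x0: "x0 \<in> {eps..w}" "v x0 \<noteq> 0" and x: "x \<in> {eps..w}"
  shows "v x = u x"
proof -
  \<comment> \<open>Positivity spreads from \<open>x0\<close> to every point: a nonnegative
    continuous integrand that is nonzero at \<open>x0\<close> has a nonzero integral.\<close>
  have v_pos: "0 < v y" if y: "y \<in> {eps..w}" for y
  proof -
    have nn: "0 \<le> U y \<xi> * (v \<xi> * gap_kernel T \<xi> (v \<xi>))" if "\<xi> \<in> {eps..w}" for \<xi>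
      using U_pos[OF y that] flux_bounds(1)[OF that] vu[OF that] by simp
    have "0 < gap_kernel T x0 (v x0)"
      using x0 eps_pos T_nonneg by (intro gap_kernel_pos) auto
    then have "U y x0 * (v x0 * gap_kernel T x0 (v x0)) \<noteq> 0"
      using U_pos[OF y x0(1)] x0(2) by simp
    then have "gap_op v y \<noteq> 0"
      unfolding gap_op_def
      using integral_eq_0_iff[OF continuous_on_integrand[OF y v(1)] eps_less nn] x0(1) by blast
    then show ?thesis using v(2)[OF y] vu[OF y] by simp
  qed
  then have u_pos: "0 < u y" if "y \<in> {eps..w}" for y
    using vu[OF that] that by fastforce
  have "continuous_on {eps..w} (\<lambda>y. v y / u y)"
    using u(1) v(1) u_pos by (intro continuous_on_divide) (auto simp: less_le)
  then obtain x1 where x1: "x1 \<in> {eps..w}" and min: "\<And>y. y \<in> {eps..w} \<Longrightarrow> v x1 / u x1 \<le> v y / u y"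
    using continuous_attains_inf[of "{eps..w}" "\<lambda>y. v y / u y"] eps_less by auto
  \<comment> \<open>The largest factor with t u \<le> v on the interval, with equality at
    \<open>x1\<close>.\<close>
  define t where "t = v x1 / u x1"
  have t_pos: "0 < t" using v_pos[OF x1] u_pos[OF x1] by (simp add: t_def)
  have tu: "t * u y \<le> v y" if "y \<in> {eps..w}" for y
    using min[OF that] u_pos[OF that] by (simp add: t_def pos_le_divide_eq)
  have "1 \<le> t"
  proof (rule ccontr)
    assume "\<not> 1 \<le> t"
    then have t: "t < 1" by simp
    have cont_tu: "continuous_on {eps..w} (\<lambda>y. t * u y)" using u(1) by (intro continuous_intros)
    have "t * gap_op u x1 = integral {eps..w} (\<lambda>\<xi>. t * (U x1 \<xi> * (u \<xi> * gap_kernel T \<xi> (u \<xi>))))"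
      by (simp add: gap_op_def)
    also have "\<dots> < gap_op (\<lambda>y. t * u y) x1"
      unfolding gap_op_def
    proof (rule integral_less_real)
      fix \<xi> assume "\<xi> \<in> {eps<..<w}"
      then have \<xi>: "\<xi> \<in> {eps..w}" and \<xi>0: "0 < \<xi>" using eps_pos by auto
      have "gap_kernel T \<xi> (u \<xi>) < gap_kernel T \<xi> (t * u \<xi>)"
        using T_nonneg \<xi>0 t t_pos u_pos[OF \<xi>] by (intro gap_kernel_strict_antimono) auto
      then have "U x1 \<xi> * (t * u \<xi>) * gap_kernel T \<xi> (u \<xi>)
          < U x1 \<xi> * (t * u \<xi>) * gap_kernel T \<xi> (t * u \<xi>)"
        using U_pos[OF x1 \<xi>] t_pos u_pos[OF \<xi>] by (intro mult_strict_left_mono) auto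
      then show "t * (U x1 \<xi> * (u \<xi> * gap_kernel T \<xi> (u \<xi>)))
          < U x1 \<xi> * (t * u \<xi> * gap_kernel T \<xi> (t * u \<xi>))"
        by (simp add: mult_ac)
    qed (use x1 u(1) cont_tu eps_less in
          \<open>auto intro!: continuous_on_mult_left continuous_on_integrand[of x1 "\<lambda>y. t * u y"]
             continuous_on_integrand[of x1 u]\<close>)
    also have "\<dots> \<le> gap_op v x1"
      using tu t_pos u_pos by (intro gap_op_mono[OF x1 cont_tu v(1)]) (auto simp: less_imp_le)
    also have "\<dots> = t * gap_op u x1"
      using v(2)[OF x1] u(2)[OF x1] u_pos[OF x1] by (simp add: t_def)
    finally show False by simp
  qed
  then have "u x \<le> t * u x" using u_pos[OF x] by simp
  then show ?thesis using tu[OF x] vu[OF x] by simp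
qed

text \<open>The bounds on \<open>U\<close> leave the integral as constants. If \<open>d\<close>
  solves the simple gap equation for \<open>U1\<close> or \<open>U2\<close>, the corresponding
  bracket equals 1, so \<open>d\<close> is a sub- or a supersolution.\<close>

lemma gap_op_const_bounds:
  assumes "x \<in> {eps..w}" "0 \<le> d"
  shows "d * (U1 * gap_integral eps w T d) \<le> gap_op (\<lambda>_. d) x"
    and "gap_op (\<lambda>_. d) x \<le> d * (U2 * gap_integral eps w T d)"
proof -
  have int: "(\<lambda>\<xi>. U x \<xi> * (d * gap_kernel T \<xi> d)) integrable_on {eps..w}"
    "(\<lambda>\<xi>. c * (d * gap_kernel T \<xi> d)) integrable_on {eps..w}" for c
    using assms by (auto intro!: integrable_continuous_interval continuous_on_integrand
        continuous_on_mult_left[OF continuous_on_flux])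
  have le: "U1 * (d * gap_kernel T \<xi> d) \<le> U x \<xi> * (d * gap_kernel T \<xi> d)"
    "U x \<xi> * (d * gap_kernel T \<xi> d) \<le> U2 * (d * gap_kernel T \<xi> d)" if "\<xi> \<in> {eps..w}" for \<xi>
    using U_bounds[OF assms(1) that] flux_bounds(1)[OF that assms(2)]
    by (auto intro!: mult_right_mono)
  show "d * (U1 * gap_integral eps w T d) \<le> gap_op (\<lambda>_. d) x"
    using integral_le[OF int(2) int(1) le(1)] by (simp add: gap_op_def gap_integral_def mult_ac)
  show "gap_op (\<lambda>_. d) x \<le> d * (U2 * gap_integral eps w T d)"
    using integral_le[OF int(1) int(2) le(2)] by (simp add: gap_op_def gap_integral_def mult_ac)
qed

end

text \<open>Let G be the gap integral as a function of \<open>d\<close>, and k, l the gaps for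
  \<open>K\<close> and \<open>L\<close>. If k > l, then 1 = K G(k) < K G(l) \<le> L G(l) = 1. Above
  \<open>tau eps w K\<close> the smaller gap is 0 by definition.\<close>

lemma Delta_mono_coupling:
  assumes "0 < K" "K \<le> L" "0 < eps" "eps < w" "K * ln (w / eps) > 1" "0 \<le> T" "T \<le> tau eps w L"
  shows "Delta eps w K T \<le> Delta eps w L T"
proof -
  have L: "0 < L" "L * ln (w / eps) > 1"
    using assms(1-5) mult_right_mono[OF assms(2), of "ln (w / eps)"]
    by (auto intro: less_le_trans)
  note DL = Delta_eq[OF assms(3,4) L assms(6,7)]
  have pos: "0 < gap_integral eps w T (Delta eps w L T)"
    using DL(2) L(1) by (metis zero_less_mult_pos zero_less_one)
  show ?thesis
  proof (cases "T \<le> tau eps w K")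
    case True
    note DK = Delta_eq[OF assms(3,4,1,5,6) True]
    show ?thesis
    proof (rule ccontr)
      assume "\<not> ?thesis"
      then have lt: "gap_integral eps w T (Delta eps w K T) < gap_integral eps w T (Delta eps w L T)"
        using DL DK assms by (intro gap_integral_strict_antimono) auto
      then have "K * gap_integral eps w T (Delta eps w K T) < K * gap_integral eps w T (Delta eps w L T)"
        using assms(1) by simp
      also have "\<dots> \<le> L * gap_integral eps w T (Delta eps w L T)"
        using assms(2) pos by (intro mult_right_mono) auto
      finally show False using DK(2) DL(2) by simp
    qed
  next
    case False
    then show ?thesis using DL by (simp add: Delta_def)
  qed
qed

section \<open>Existence and uniqueness\<close>

theorem theorem8:
  fixes U1 U2 eps w T :: real and U :: "real \<Rightarrow> real \<Rightarrow> real"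
  assumes "0 < U1" and "U1 < U2"
    and "0 < eps" and "eps < w"
    and "U1 * ln (w / eps) > 1"
    and "continuous_on ({eps..w} \<times> {eps..w}) (\<lambda>(x, \<xi>). U x \<xi>)"
    and "\<forall>x\<in>{eps..w}. \<forall>\<xi>\<in>{eps..w}. U1 \<le> U x \<xi> \<and> U x \<xi> \<le> U2"
    and "T \<in> {0..tau eps w U2}"
  shows "\<exists>u0 \<in> V eps w U1 U2 T.
           (\<forall>x\<in>{eps..w}. 0 \<le> u0 x) \<and>
           solves_gap_eq eps w U T u0 \<and>
           (\<forall>v \<in> V eps w U1 U2 T. solves_gap_eq eps w U T v \<longrightarrow>
              (\<forall>x\<in>{eps..w}. v x = u0 x) \<or>
              (tau eps w U1 \<le> T \<and> (\<forall>x\<in>{eps..w}. v x = 0))) \<and>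
           continuous_on {eps..w} u0 \<and>
           (\<forall>x\<in>{eps..w}. Delta eps w U1 T \<le> u0 x \<and> u0 x \<le> Delta eps w U2 T)"
proof -
  have T: "0 \<le> T" "T \<le> tau eps w U2" using assms(8) by auto
  interpret gap_equation U1 U2 eps w T U
    using assms T by unfold_locales auto
  have U2: "0 < U2" "U2 * ln (w / eps) > 1"
    using assms(1-5) mult_right_mono[of U1 U2 "ln (w / eps)"]
    by (auto intro: less_le_trans)
  let ?a = "Delta eps w U1 T" and ?b = "Delta eps w U2 T"
  have a: "0 \<le> ?a" using assms T by (intro Delta_nonneg) auto
  have ab: "?a \<le> ?b" using assms T by (intro Delta_mono_coupling) auto
  \<comment> \<open>Up to \<open>tau eps w U1\<close> this is the simple gap equation for
    \<open>U1\<close>; above it \<open>?a\<close> is 0, and the zero function is a fixed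
    point.\<close>
  have sub: "?a \<le> gap_op (\<lambda>_. ?a) x" if x: "x \<in> {eps..w}" for x
  proof (cases "T \<le> tau eps w U1")
    case True
    then show ?thesis
      using Delta_eq[OF assms(3,4,1,5) T(1)] gap_op_const_bounds(1)[OF x a] by simp
  next
    case False
    then show ?thesis by (simp add: Delta_def gap_op_def)
  qed
  have sup: "gap_op (\<lambda>_. ?b) x \<le> ?b" if x: "x \<in> {eps..w}" for x
    using Delta_eq[OF assms(3,4) U2 T] gap_op_const_bounds(2)[OF x, of ?b] by simp
  obtain u where u: "continuous_on {eps..w} u" "\<And>x. x \<in> {eps..w} \<Longrightarrow> ?a \<le> u x \<and> u x \<le> ?b"
    "\<And>x. x \<in> {eps..w} \<Longrightarrow> u x = gap_op u x"
    "\<And>v x. continuous_on {eps..w} v \<Longrightarrow> (\<And>\<xi>. \<xi> \<in> {eps..w} \<Longrightarrow> 0 \<le> v \<xi> \<and> v \<xi> \<le> ?b) \<Longrightarrow>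
       (\<And>\<xi>. \<xi> \<in> {eps..w} \<Longrightarrow> v \<xi> = gap_op v \<xi>) \<Longrightarrow> x \<in> {eps..w} \<Longrightarrow> v x \<le> u x"
    using maximal_solution[OF a ab sub sup] by metis
  have uniq: "(\<forall>x\<in>{eps..w}. v x = u x) \<or> (tau eps w U1 \<le> T \<and> (\<forall>x\<in>{eps..w}. v x = 0))"
    if "v \<in> V eps w U1 U2 T" "solves_gap_eq eps w U T v" for v
  proof -
    have v: "continuous_on {eps..w} v" "\<And>x. x \<in> {eps..w} \<Longrightarrow> ?a \<le> v x \<and> v x \<le> ?b"
      "\<And>x. x \<in> {eps..w} \<Longrightarrow> v x = gap_op v x"
      using that by (auto simp: V_def solves_gap_eq_iff)
    have v0: "0 \<le> v x \<and> v x \<le> ?b" if "x \<in> {eps..w}" for x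
      using v(2)[OF that] a by linarith
    \<comment> \<open>Maximality of \<open>u\<close> puts the two solutions in order.\<close>
    have vu: "0 \<le> v x \<and> v x \<le> u x" if "x \<in> {eps..w}" for x
      using u(4)[OF v(1) v0 v(3) that] v0[OF that] by blast
    show ?thesis
    proof (cases "\<forall>x\<in>{eps..w}. v x = 0")
      case True
      \<comment> \<open>The zero function lies in \<open>V\<close> only if the lower gap vanishes,
        which cannot happen below the critical temperature of \<open>U1\<close>.\<close>
      then have "?a \<le> 0" using v(2)[of eps] assms(4) by auto
      then have "tau eps w U1 \<le> T"
        using Delta_pos[OF assms(3,4,1,5) T(1)] by linarith
      then show ?thesis using True by blast
    next
      case False
      then obtain x0 where "x0 \<in> {eps..w}" "v x0 \<noteq> 0" by blast
      then show ?thesis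
        using comparable_solutions_eq[OF u(1,3) v(1,3) vu] by blast
    qed
  qed
  show ?thesis
  proof (intro bexI[of _ u] conjI ballI impI)
    show "u \<in> V eps w U1 U2 T" using u(1,2) by (simp add: V_def)
    show "solves_gap_eq eps w U T u" using u(3) by (simp add: solves_gap_eq_iff)
    show "0 \<le> u x" if "x \<in> {eps..w}" for x using u(2)[OF that] a by linarith
  qed (use u uniq in auto)
qed

end
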